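(* Consider the unicycle system $$\dot x=u\cos\theta,\qquad \dot y=u\sin\theta,\qquad \dot\theta=\omega,$$ with position $\mathbf r=(x,y)^T\in\mathbb R^2$, orientation $\theta$, and control input $(u,\omega)$. Let $\mathbf r_g(t)\in\mathbb R^2$ be a continuously differentiable desired trajectory, let $\mathbf r_e(t)=\mathbf r(t)-\mathbf r_g(t)$, let $k>0$, $k_\omega>0$, $0<\alpha<1$, and define the vector field $$\mathbf F_p=-k\,\mathbf r_e(t)\,\|\mathbf r_e(t)\|^{\alpha-1}+\dot{\mathbf r}_g(t).$$ Let $\varphi_p$ be the orientation of $\mathbf F_p$. Then, under the control law $$u=\|\mathbf F_p\|,\qquad \omega=-k_\omega\operatorname{sign}(\theta-\varphi_p)\,|\theta-\varphi_p|^{\alpha}+\dot\varphi_p,$$ the system tracks the trajectory $\mathbf r_g(t)$ in finite time, i.e. there exists $T<\infty$ such that $\mathbf r(t)=\mathbf r_g(t)$ for all $t\ge T$.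
   Context: $\|\cdot\|$ is the Euclidean norm; $\operatorname{sign}(x)=-1,0,1$ for $x<0$, $x=0$, $x>0$. The expression $\mathbf r_e\|\mathbf r_e\|^{\alpha-1}$ is understood as $\mathbf 0$ when $\mathbf r_e=\mathbf 0$. The orientation $\varphi_p$ of $\mathbf F_p=(F_{px},F_{py})^T$ is its signed angle $\angle\mathbf F_p$, written $\varphi_p=\arctan(F_{py}/F_{px})$, so that $\mathbf F_p=\|\mathbf F_p\|(\cos\varphi_p,\sin\varphi_p)^T$; $\dot\varphi_p$ is its time derivative along the closed-loop trajectory, which the control law presupposes to exist. *)

theory Defs
  imports "HOL-Analysis.Analysis"
begin

text \<open>
  Time ranges over \<open>{0..}\<close>; derivatives are taken within this set, so they are one-sided
  at time 0 and two-sided at later times.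
\<close>

definition unicycle ::
    "(real \<Rightarrow> real) \<Rightarrow> (real \<Rightarrow> real) \<Rightarrow> (real \<Rightarrow> real) \<Rightarrow> (real \<Rightarrow> real) \<Rightarrow> (real \<Rightarrow> real) \<Rightarrow> bool"
  where
  "unicycle x y \<theta> u \<omega> \<longleftrightarrow>
    (\<forall>t\<ge>0.
      (x has_real_derivative u t * cos (\<theta> t)) (at t within {0..}) \<and>
      (y has_real_derivative u t * sin (\<theta> t)) (at t within {0..}) \<and>
      (\<theta> has_real_derivative \<omega> t) (at t within {0..}))"

text \<open>
  The field depends on the current error \<open>e\<close> and reference velocity \<open>v\<close>.
  For \<open>e = 0\<close> the first summand is \<open>0\<close>, because the scalar factor multiplies
  the zero vector.
\<close>

definition tracking_field :: "real \<Rightarrow> real \<Rightarrow> real ^ 2 \<Rightarrow> real ^ 2 \<Rightarrow> real ^ 2"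
  where
  "tracking_field k \<alpha> e v = - k *\<^sub>R ((norm e powr (\<alpha> - 1)) *\<^sub>R e) + v"

text \<open>
  The angle is determined modulo \<open>2 * pi\<close> when \<open>F \<noteq> 0\<close>, so a time-dependent
  orientation may be any branch, in particular a continuous one; for \<open>F = 0\<close> every
  angle qualifies.
\<close>

definition is_orientation :: "real \<Rightarrow> real ^ 2 \<Rightarrow> bool"
  where
  "is_orientation \<phi> F \<longleftrightarrow> F = norm F *\<^sub>R vector [cos \<phi>, sin \<phi>]"

end

theory Submission
  imports Defs
begin

text \<open>
  Both the heading error \<open>\<theta> - \<phi>\<close> and, once it has vanished, the position error obey
  \<open>e' = - c \<bar>e\<bar>\<^sup>\<alpha>\<^sup>-\<^sup>1 e\<close>: with \<open>\<theta> = \<phi>\<close> the velocity of the vehicle is exactly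
  the field. Along this flow the Lyapunov function \<open>W = \<bar>e\<bar>\<^sup>2\<close> satisfies
  \<open>W' = - 2 c W\<^sup>\<beta>\<close> with \<open>\<beta> = (1 + \<alpha>) / 2 < 1\<close>, so \<open>W\<^sup>1\<^sup>-\<^sup>\<beta>\<close> decreases at a constant
  rate for as long as it is positive.
\<close>

text \<open>While \<open>W\<close> is positive, \<open>W powr (1 - \<beta>)\<close> has slope at
  most \<open>- (1 - \<beta>) * c\<close>, so it would have to become negative after a time fixed by
  \<open>W a\<close>. The start time \<open>a\<close> is arbitrary so that the flow can also be
  entered late.\<close>

lemma powr_decay_finite_time:
  fixes W D :: "real \<Rightarrow> real" and a c \<beta> :: real
  assumes c: "c > 0" and \<beta>: "\<beta> < 1"
    and nonneg: "\<And>t. t \<ge> a \<Longrightarrow> W t \<ge> 0"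
    and deriv: "\<And>t. t \<ge> a \<Longrightarrow> (W has_real_derivative D t) (at t within {a..})"
    and decay: "\<And>t. t \<ge> a \<Longrightarrow> D t \<le> - c * W t powr \<beta>"
  shows "\<exists>T\<ge>a. \<forall>t\<ge>T. W t = 0"
proof -
  have cont: "continuous_on {a..} W"
    by (rule DERIV_continuous_on[where D = D], rule deriv) simp
  have deriv_at: "(W has_real_derivative D t) (at t)" if "t > a" for t
    using deriv[of t] that by (simp add: at_within_interior[of t "{a..}"])
  have mono: "W t \<le> W s" if "a \<le> s" "s \<le> t" for s t
  proof (rule DERIV_nonpos_imp_decreasing_open[OF \<open>s \<le> t\<close>])
    fix z assume z: "s < z" "z < t"
    have "D z \<le> 0"
      using decay[of z] c z that by (smt (verit) mult_nonneg_nonneg mult_minus_left powr_ge_zero)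
    then show "\<exists>d. (W has_real_derivative d) (at z) \<and> d \<le> 0"
      using deriv_at[of z] z that by auto
  qed (rule continuous_on_subset[OF cont], use that in auto)
  \<comment> \<open>The zero of the line through \<open>W a powr (1 - \<beta>)\<close> at
    \<open>a\<close> with slope \<open>- (1 - \<beta>) * c\<close>.\<close>
  define T where "T = a + W a powr (1 - \<beta>) / ((1 - \<beta>) * c)"
  have aT: "a \<le> T"
    using c \<beta> by (simp add: T_def)
  have "W t = 0" if "t \<ge> T" for t
  proof (rule ccontr)
    assume "W t \<noteq> 0"
    then have at: "a \<le> t" and Wt: "W t > 0"
      using that aT nonneg[of t] by auto
    \<comment> \<open>Monotonicity carries positivity back from \<open>t\<close> to all of
      \<open>{a..t}\<close>, which keeps \<open>W\<close> away from the point where the power may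
      fail to be differentiable.\<close>
    have pos: "W s > 0" if "a \<le> s" "s \<le> t" for s
      using mono[OF that] Wt by linarith
    let ?G = "\<lambda>s. W s powr (1 - \<beta>) + (1 - \<beta>) * c * s"
    have "?G t \<le> ?G a"
    proof (rule DERIV_nonpos_imp_decreasing_open[OF at])
      fix z assume z: "a < z" "z < t"
      then have Wz: "W z > 0" using pos by simp
      have G_deriv: "(?G has_real_derivative
          (1 - \<beta>) * W z powr (- \<beta>) * D z + (1 - \<beta>) * c) (at z)"
        using Wz by (auto intro!: derivative_eq_intros deriv_at[OF z(1)])
      have "W z powr (- \<beta>) * D z \<le> W z powr (- \<beta>) * (- c * W z powr \<beta>)"
        using decay[of z] z by (intro mult_left_mono) auto
      also have "\<dots> = - c"
        using Wz by (simp add: powr_minus field_simps)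
      finally have "(1 - \<beta>) * (W z powr (- \<beta>) * D z) \<le> (1 - \<beta>) * (- c)"
        using \<beta> by (intro mult_left_mono) auto
      then have "(1 - \<beta>) * W z powr (- \<beta>) * D z + (1 - \<beta>) * c \<le> 0"
        by (simp add: algebra_simps)
      with G_deriv show "\<exists>d. (?G has_real_derivative d) (at z) \<and> d \<le> 0"
        by blast
    next
      show "continuous_on {a..t} ?G"
        by (intro continuous_intros continuous_on_subset[OF cont]) (use pos in force)+
    qed
    moreover have "W t powr (1 - \<beta>) > 0" using Wt by simp
    ultimately have "(1 - \<beta>) * c * (t - a) < W a powr (1 - \<beta>)"
      unfolding right_diff_distrib by linarith
    then have "t - a < W a powr (1 - \<beta>) / ((1 - \<beta>) * c)"
      using c \<beta> by (simp add: pos_less_divide_eq mult.commute)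
    then show False using that by (simp add: T_def)
  qed
  then show ?thesis using aT by blast
qed

text \<open>A general inner product space covers both the scalar heading error and the planar
  position error. The squared norm serves as Lyapunov function because, unlike the norm, it is also
  differentiable where \<open>e\<close> vanishes.\<close>

lemma norm_powr_flow_finite_time:
  fixes e :: "real \<Rightarrow> 'a::real_inner" and a c \<alpha> :: real
  assumes "c > 0" and "\<alpha> < 1"
    and deriv: "\<And>t. t \<ge> a \<Longrightarrow>
      (e has_vector_derivative - c *\<^sub>R (norm (e t) powr (\<alpha> - 1) *\<^sub>R e t)) (at t within {a..})"
  shows "\<exists>T\<ge>a. \<forall>t\<ge>T. e t = 0"
proof -
  have "\<exists>T\<ge>a. \<forall>t\<ge>T. (norm (e t))\<^sup>2 = 0"
  proof (rule powr_decay_finite_time[where c = "2 * c" and \<beta> = "(1 + \<alpha>) / 2"])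
    fix t assume t: "a \<le> t"
    let ?v = "- c *\<^sub>R (norm (e t) powr (\<alpha> - 1) *\<^sub>R e t)"
    have "((\<lambda>s. e s \<bullet> e s) has_derivative (\<lambda>h. e t \<bullet> (h *\<^sub>R ?v) + (h *\<^sub>R ?v) \<bullet> e t)) (at t within {a..})"
      using deriv[OF t] by (intro has_derivative_inner) (auto simp: has_vector_derivative_def)
    then show "((\<lambda>s. (norm (e s))\<^sup>2) has_real_derivative 2 * (e t \<bullet> ?v)) (at t within {a..})"
      unfolding has_field_derivative_def power2_norm_eq_inner
      by (rule has_derivative_eq_rhs) (auto simp: inner_commute algebra_simps)
    \<comment> \<open>This makes the decay condition an equality. At \<open>e t = 0\<close> both
      sides are \<open>0\<close>, since \<open>0 powr p = 0\<close> for every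
      \<open>p\<close>.\<close>
    have "(norm (e t))\<^sup>2 powr ((1 + \<alpha>) / 2) = norm (e t) powr (\<alpha> - 1) * (norm (e t))\<^sup>2"
    proof (cases "e t = 0")
      case False
      then have sq: "(norm (e t))\<^sup>2 = norm (e t) powr 2" by simp
      have exponent: "2 * ((1 + \<alpha>) / 2) = (\<alpha> - 1) + 2" by (simp add: field_simps)
      show ?thesis
        unfolding sq powr_powr powr_add[symmetric] exponent ..
    qed simp
    then show "2 * (e t \<bullet> ?v) \<le> - (2 * c) * (norm (e t))\<^sup>2 powr ((1 + \<alpha>) / 2)"
      by (simp add: power2_norm_eq_inner)
  qed (use assms in auto)
  then show ?thesis by simp
qed

lemma has_vector_derivative_vector_2:
  fixes x y :: "real \<Rightarrow> real"
  assumes "(x has_real_derivative x') (at t within S)"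
    and "(y has_real_derivative y') (at t within S)"
  shows "((\<lambda>s. vector [x s, y s] :: real ^ 2) has_vector_derivative vector [x', y']) (at t within S)"
proof -
  have vec: "(vector [a, b] :: real ^ 2) = a *\<^sub>R axis 1 1 + b *\<^sub>R axis 2 1" for a b :: real
    by (simp add: vec_eq_iff forall_2 axis_def)
  show ?thesis
    unfolding vec using assms
    by (intro has_vector_derivative_add bounded_linear.has_vector_derivative[OF bounded_linear_scaleR_left])
       (simp_all add: has_real_derivative_iff_has_vector_derivative)
qed

theorem theorem4:
  fixes x y \<theta> u \<omega> \<phi> \<phi>' :: "real \<Rightarrow> real"
    and r r\<^sub>g r\<^sub>g' r\<^sub>e F :: "real \<Rightarrow> real ^ 2"
    and k k\<^sub>\<omega> \<alpha> :: real
  assumes "k > 0" and "k\<^sub>\<omega> > 0" and "0 < \<alpha>" and "\<alpha> < 1"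
    and r_def: "\<And>t. r t = vector [x t, y t]"
    and ref_deriv: "\<And>t. t \<ge> 0 \<Longrightarrow> (r\<^sub>g has_vector_derivative r\<^sub>g' t) (at t within {0..})"
    and ref_C1: "continuous_on {0..} r\<^sub>g'"
    and error_def: "\<And>t. r\<^sub>e t = r t - r\<^sub>g t"
    and field_def: "\<And>t. F t = tracking_field k \<alpha> (r\<^sub>e t) (r\<^sub>g' t)"
    and orientation: "\<And>t. t \<ge> 0 \<Longrightarrow> is_orientation (\<phi> t) (F t)"
    and orientation_deriv: "\<And>t. t \<ge> 0 \<Longrightarrow> (\<phi> has_real_derivative \<phi>' t) (at t within {0..})"
    and system: "unicycle x y \<theta> u \<omega>"
    and control_u: "\<And>t. t \<ge> 0 \<Longrightarrow> u t = norm (F t)"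
    and control_omega: "\<And>t. t \<ge> 0 \<Longrightarrow>
      \<omega> t = - k\<^sub>\<omega> * sgn (\<theta> t - \<phi> t) * \<bar>\<theta> t - \<phi> t\<bar> powr \<alpha> + \<phi>' t"
  shows "\<exists>T\<ge>0. \<forall>t\<ge>T. r t = r\<^sub>g t"
proof -
  let ?\<delta> = "\<lambda>t. \<theta> t - \<phi> t"
  have "\<exists>T\<ge>0. \<forall>t\<ge>T. ?\<delta> t = 0"
  proof (rule norm_powr_flow_finite_time[where c = k\<^sub>\<omega> and \<alpha> = \<alpha>])
    fix t :: real assume t: "0 \<le> t"
    \<comment> \<open>The signed power of the control law is the one-dimensional case of the field
      in the flow lemma; the term \<open>\<phi>' t\<close> cancels in the derivative of the
      difference.\<close>
    have "sgn (?\<delta> t) * \<bar>?\<delta> t\<bar> powr \<alpha> = \<bar>?\<delta> t\<bar> powr (\<alpha> - 1) * ?\<delta> t"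
    proof (cases "?\<delta> t = 0")
      case False
      then have "\<bar>?\<delta> t\<bar> powr \<alpha> = \<bar>?\<delta> t\<bar> powr (\<alpha> - 1) * \<bar>?\<delta> t\<bar>"
        by (simp add: powr_mult_base mult.commute)
      then show ?thesis
        by (metis mult.left_commute sgn_mult_abs)
    qed simp
    then have "\<omega> t - \<phi>' t = - k\<^sub>\<omega> *\<^sub>R (norm (?\<delta> t) powr (\<alpha> - 1) *\<^sub>R ?\<delta> t)"
      using control_omega[OF t] by simp
    moreover have "(?\<delta> has_real_derivative \<omega> t - \<phi>' t) (at t within {0..})"
      using system t orientation_deriv[OF t]
      unfolding unicycle_def by (intro DERIV_diff) auto
    ultimately show "(?\<delta> has_vector_derivative
        - k\<^sub>\<omega> *\<^sub>R (norm (?\<delta> t) powr (\<alpha> - 1) *\<^sub>R ?\<delta> t)) (at t within {0..})"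
      by (simp only: has_real_derivative_iff_has_vector_derivative)
  qed (use assms in auto)
  then obtain T where T: "T \<ge> 0" and aligned: "\<And>t. t \<ge> T \<Longrightarrow> \<theta> t = \<phi> t"
    by auto
  \<comment> \<open>The trajectory exists on all of \<open>{0..}\<close>, so whatever the position
    error has become by time \<open>T\<close> serves as the initial value of a second flow.\<close>
  have "\<exists>T'\<ge>T. \<forall>t\<ge>T'. r\<^sub>e t = 0"
  proof (rule norm_powr_flow_finite_time[OF \<open>k > 0\<close> \<open>\<alpha> < 1\<close>])
    fix t assume t: "T \<le> t"
    then have t0: "t \<ge> 0" using T by simp
    \<comment> \<open>Alignment turns the velocity into the polar form of \<open>F t\<close>. If
      \<open>F t = 0\<close>, the speed is \<open>0\<close> and the choice of angle is
      harmless.\<close>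
    have "vector [u t * cos (\<theta> t), u t * sin (\<theta> t)] = norm (F t) *\<^sub>R (vector [cos (\<phi> t), sin (\<phi> t)] :: real ^ 2)"
      using control_u[OF t0] aligned[OF t] by (simp add: vec_eq_iff forall_2)
    also have "\<dots> = F t"
      using orientation[OF t0] by (simp add: is_orientation_def)
    finally have velocity: "vector [u t * cos (\<theta> t), u t * sin (\<theta> t)] = F t" .
    have "((\<lambda>s. vector [x s, y s] :: real ^ 2) has_vector_derivative F t) (at t within {0..})"
      using system t0 unfolding velocity[symmetric] unicycle_def
      by (intro has_vector_derivative_vector_2) auto
    then have "(r has_vector_derivative F t) (at t within {0..})"
      by (simp add: r_def[abs_def])
    from has_vector_derivative_diff[OF this ref_deriv[OF t0]]
    have "(r\<^sub>e has_vector_derivative F t - r\<^sub>g' t) (at t within {0..})"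
      by (simp add: error_def[abs_def])
    then have "(r\<^sub>e has_vector_derivative F t - r\<^sub>g' t) (at t within {T..})"
      by (rule has_vector_derivative_within_subset) (use T in auto)
    \<comment> \<open>Subtracting the reference velocity leaves only the feedback term of the
      field.\<close>
    then show "(r\<^sub>e has_vector_derivative
        - k *\<^sub>R (norm (r\<^sub>e t) powr (\<alpha> - 1) *\<^sub>R r\<^sub>e t)) (at t within {T..})"
      by (simp add: field_def tracking_field_def)
  qed
  then show ?thesis
    using T by (auto simp: error_def intro: order_trans)
qed

end
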